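(* Let $d\in\mathbb{N}$, $d\ge 2$, and let $\alpha,\beta,\gamma\in\mathbb{R}$ satisfy $\alpha>\gamma-\beta\ge 0$ and $\alpha+\beta>\frac12$. Then for all $M\in\mathbb{N}$ $$g^{\mathrm{latt}_1}_M(\mathcal{H}^{\alpha,\beta}(\mathbb{T}^d),\mathcal{H}^{\gamma}(\mathbb{T}^d))\ \ge\ 2^{-(\alpha+\beta-\gamma+1)/2}\,M^{-(\alpha+\beta-\gamma)/2}$$ and $$g^{\mathrm{latt}_1}_M(\mathcal{H}^{\alpha,\beta}(\mathbb{T}^d),\mathcal{H}^{\gamma}_{\mathrm{mix}}(\mathbb{T}^d))\ \ge\ 2^{-(\alpha+\beta-\gamma+1)/2}\,M^{-(\alpha+\beta-\gamma)/2}.$$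
   Context: $\mathbb{T}=[0,1)$ is the torus, $\hat f_{\boldsymbol k}=\int_{\mathbb{T}^d}f(\boldsymbol x)e^{-2\pi i\boldsymbol k\cdot\boldsymbol x}\,d\boldsymbol x$. For real $\alpha,\beta$, $\mathcal{H}^{\alpha,\beta}(\mathbb{T}^d)$ is the space of $f\in L_2(\mathbb{T}^d)$ with finite norm $$\|f|\mathcal{H}^{\alpha,\beta}(\mathbb{T}^d)\|^2=\sum_{\boldsymbol k\in\mathbb{Z}^d}|\hat f_{\boldsymbol k}|^2(1+\|\boldsymbol k\|_2^2)^{\beta}\prod_{s=1}^d(1+|k_s|^2)^{\alpha}.$$ Put $\mathcal{H}^{\gamma}(\mathbb{T}^d):=\mathcal{H}^{0,\gamma}(\mathbb{T}^d)$ and $\mathcal{H}^{\gamma}_{\mathrm{mix}}(\mathbb{T}^d):=\mathcal{H}^{\gamma,0}(\mathbb{T}^d)$. For $\boldsymbol z\in\mathbb{Z}^d$, $M\in\mathbb{N}$, the rank-1 lattice $\Lambda(\boldsymbol z,M)$ consists of the points $\boldsymbol x_j=\frac{j}{M}\boldsymbol z\bmod\boldsymbol 1$, $j=0,\dots,M-1$. Define $$\operatorname{Samp}_{\Lambda(\boldsymbol z,M)}(\mathcal F,Y):=\inf_{A:\mathbb{C}^M\to Y}\ \sup_{\|f|\mathcal F\|\le1}\big\|f-A\big((f(\boldsymbol x_j))_{j=0}^{M-1}\big)\big\|_Y,$$ where $A$ ranges over all (possibly non-linear) maps, and $$g_M^{\mathrm{latt}_1}(\mathcal F,Y):=\inf_{\boldsymbol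 z\in\mathbb{Z}^d}\operatorname{Samp}_{\Lambda(\boldsymbol z,M)}(\mathcal F,Y).$$ Function values refer to the continuous representative; the supremum is over those $f$ in the unit ball of $\mathcal F$ that have one (all of them when $\mathcal F\hookrightarrow C(\mathbb{T}^d)$, e.g. when $\min\{\alpha,\alpha+\beta\}>\frac12$). The norm $\|\cdot\|_Y$ is set to $+\infty$ outside $Y$. *)

theory Defs
  imports "HOL-Analysis.Analysis"
begin

text \<open>Functions on the torus \<open>[0,1)\<^sup>d\<close> are represented by functions on \<^typ>\<open>real^'d\<close>; only
  their values on \<open>torus\<close> are used.\<close>

definition torus :: "(real^'d) set" where
  "torus = {x. \<forall>i. 0 \<le> x $ i \<and> x $ i < 1}"

definition wrap :: "real^'d \<Rightarrow> real^'d" where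
  "wrap x = (\<chi> i. frac (x $ i))"

text \<open>Continuity in the quotient topology, i.e. of the 1-periodic extension.\<close>

definition continuous_torus :: "(real^'d \<Rightarrow> complex) \<Rightarrow> bool" where
  "continuous_torus f \<longleftrightarrow> continuous_on UNIV (\<lambda>x. f (wrap x))"

definition L2_torus :: "(real^'d \<Rightarrow> complex) set" where
  "L2_torus = {f \<in> borel_measurable (lebesgue_on torus).
                 integrable (lebesgue_on torus) (\<lambda>x. (cmod (f x))\<^sup>2)}"

definition fourier_coeff :: "(real^'d \<Rightarrow> complex) \<Rightarrow> int^'d \<Rightarrow> complex" where
  "fourier_coeff f k =
     (LINT x|lebesgue_on torus.
        f x * exp (- 2 * of_real pi * \<i> * of_real (\<Sum>s\<in>UNIV. of_int (k $ s) * x $ s)))"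

definition H_weight :: "real \<Rightarrow> real \<Rightarrow> int^'d \<Rightarrow> real" where
  "H_weight \<alpha> \<beta> k =
     (1 + (\<Sum>s\<in>UNIV. (real_of_int (k $ s))\<^sup>2)) powr \<beta>
     * (\<Prod>s\<in>UNIV. (1 + \<bar>real_of_int (k $ s)\<bar>\<^sup>2) powr \<alpha>)"

definition H_space :: "real \<Rightarrow> real \<Rightarrow> (real^'d \<Rightarrow> complex) set" where
  "H_space \<alpha> \<beta> =
     {f \<in> L2_torus. (\<lambda>k. (cmod (fourier_coeff f k))\<^sup>2 * H_weight \<alpha> \<beta> k) summable_on UNIV}"

definition H_norm :: "real \<Rightarrow> real \<Rightarrow> (real^'d \<Rightarrow> complex) \<Rightarrow> ennreal" where
  "H_norm \<alpha> \<beta> f =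
     (if f \<in> H_space \<alpha> \<beta>
      then ennreal (sqrt (\<Sum>\<^sub>\<infinity>k\<in>UNIV. (cmod (fourier_coeff f k))\<^sup>2 * H_weight \<alpha> \<beta> k))
      else \<infinity>)"

abbreviation H_iso_norm :: "real \<Rightarrow> (real^'d \<Rightarrow> complex) \<Rightarrow> ennreal" where
  "H_iso_norm \<gamma> \<equiv> H_norm 0 \<gamma>"

abbreviation H_mix_norm :: "real \<Rightarrow> (real^'d \<Rightarrow> complex) \<Rightarrow> ennreal" where
  "H_mix_norm \<gamma> \<equiv> H_norm \<gamma> 0"

definition lattice_point :: "int^'d \<Rightarrow> nat \<Rightarrow> nat \<Rightarrow> real^'d" where
  "lattice_point z M j = wrap (\<chi> s. real j / real M * of_int (z $ s))"

text \<open>A space enters through its extended norm, which is infinite exactly outside the space.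
  Quantifying over the continuous functions in the unit ball amounts to quantifying over the
  \<open>L\<^sub>2\<close>-classes with a continuous representative and evaluating that representative.
  The set \<open>{..<M} \<rightarrow>\<^sub>E UNIV\<close> is \<open>\<complex>\<^sup>M\<close>.\<close>

definition Samp_lattice ::
  "int^'d \<Rightarrow> nat \<Rightarrow> ((real^'d \<Rightarrow> complex) \<Rightarrow> ennreal) \<Rightarrow> ((real^'d \<Rightarrow> complex) \<Rightarrow> ennreal) \<Rightarrow> ennreal"
where
  "Samp_lattice z M normF normY =
     (INF A \<in> ({..<M} \<rightarrow>\<^sub>E (UNIV :: complex set)) \<rightarrow> {g. normY g < \<infinity>}.
        SUP f \<in> {f. continuous_torus f \<and> normF f \<le> 1}.
          normY (\<lambda>x. f x - A (\<lambda>j\<in>{..<M}. f (lattice_point z M j)) x))"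

definition g_latt1 ::
  "nat \<Rightarrow> ((real^'d \<Rightarrow> complex) \<Rightarrow> ennreal) \<Rightarrow> ((real^'d \<Rightarrow> complex) \<Rightarrow> ennreal) \<Rightarrow> ennreal"
where
  "g_latt1 M normF normY = (INF z. Samp_lattice z M normF normY)"

end

theory Submission imports Defs begin

text \<open>By the pigeonhole principle there are two frequencies on different coordinate axes, of size
  at most \<open>\<surd>M\<close>, whose characters agree at all points of the lattice. A multiple \<open>f\<close> of their
  difference vanishes there, so the reconstruction sees the same data for \<open>f\<close> and \<open>-f\<close>, and its
  error on one of them is at least the contribution of a single Fourier coefficient of \<open>f\<close>.
  On the axes the weights of both target norms are \<open>(1 + n\<^sup>2)\<^bsup>\<gamma>\<^esup>\<close>.\<close>

section \<open>Characters of the torus and their values at lattice points\<close>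

definition character :: "int^'d \<Rightarrow> real^'d \<Rightarrow> complex" where
  "character k x = cis (2 * pi * (\<Sum>s\<in>UNIV. real_of_int (k $ s) * x $ s))"

lemma norm_character [simp]: "cmod (character k x) = 1"
  by (simp add: character_def)

lemma character_measurable [measurable]: "character k \<in> borel_measurable borel"
  unfolding character_def[abs_def] cis_conv_exp
  by (intro borel_measurable_continuous_onI continuous_intros)

lemma character_mult_minus: "character h x * character (- k) x = character (h - k) x"
  by (simp add: character_def cis_mult sum_distrib_left flip: sum.distrib)
     (simp add: algebra_simps)

lemma fourier_coeff_eq_integral:
  "fourier_coeff f k = (LINT x|lebesgue_on torus. f x * character (- k) x)"
  unfolding fourier_coeff_def character_def cis_conv_exp
  by (simp add: sum_negf mult_ac)

lemma cis_2pi_int_add: "m \<in> \<int> \<Longrightarrow> cis (2 * pi * (m + t)) = cis (2 * pi * t)"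
  by (simp add: distrib_left flip: cis_mult)

text \<open>Wrapping removes the integer part of each coordinate, which moves the phase by
  \<open>2 * pi\<close> times an integer. This gives continuity in the sense of
  \<open>continuous_torus\<close> and lets lattice points be handled without reduction modulo
  1.\<close>

lemma character_wrap: "character k (wrap x) = character k x"
proof -
  have "character k x = cis (2 * pi * ((\<Sum>s\<in>UNIV. of_int (k $ s) * of_int \<lfloor>x $ s\<rfloor>)
      + (\<Sum>s\<in>UNIV. of_int (k $ s) * wrap x $ s)))"
    unfolding character_def wrap_def
    by (simp add: frac_def right_diff_distrib sum_subtractf)
  also have "\<dots> = character k (wrap x)"
    unfolding character_def by (rule cis_2pi_int_add) (intro Ints_sum Ints_mult Ints_of_int)
  finally show ?thesis ..
qed

text \<open>Before wrapping, the two phases differ by \<open>2 * pi * j / M\<close> times the sum in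
  the hypothesis; divisibility by \<open>M\<close> makes this an integer multiple of
  \<open>2 * pi\<close>.\<close>

lemma character_lattice_point_eq:
  assumes "int M dvd (\<Sum>s\<in>UNIV. (k $ s - h $ s) * z $ s)" "M \<ge> 1"
  shows "character k (lattice_point z M j) = character h (lattice_point z M j)"
proof -
  obtain q where q: "(\<Sum>s\<in>UNIV. (k $ s - h $ s) * z $ s) = int M * q"
    using assms(1) by blast
  define y :: "real^'a" where "y = (\<chi> s. real j / real M * of_int (z $ s))"
  have "(\<Sum>s\<in>UNIV. of_int (k $ s) * y $ s) - (\<Sum>s\<in>UNIV. of_int (h $ s) * y $ s)
      = real j / real M * real_of_int (\<Sum>s\<in>UNIV. (k $ s - h $ s) * z $ s)"
    by (simp add: y_def sum_distrib_left algebra_simps flip: sum_subtractf)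
  also have "\<dots> = real_of_int (int j * q)"
    using assms(2) by (simp add: q)
  finally have "(\<Sum>s\<in>UNIV. of_int (k $ s) * y $ s)
      = real_of_int (int j * q) + (\<Sum>s\<in>UNIV. of_int (h $ s) * y $ s)"
    by simp
  then have "character k y = character h y"
    unfolding character_def by (simp only: cis_2pi_int_add Ints_of_int)
  then show ?thesis
    by (simp add: lattice_point_def character_wrap y_def)
qed

lemma continuous_torus_character_diff: "continuous_torus (\<lambda>x. c * (character k x - character h x))"
  unfolding continuous_torus_def character_wrap unfolding character_def cis_conv_exp
  by (intro continuous_intros)

section \<open>Integration over the torus and orthogonality of the characters\<close>

lemma torus_borel [measurable]: "torus \<in> sets borel"
  unfolding torus_def by measurable

lemma finite_measure_torus: "finite_measure (lebesgue_on (torus :: (real^'d) set))"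
proof (rule finite_measure_lebesgue_on)
  have "torus \<subseteq> (cbox 0 1 :: (real^'d) set)"
    by (auto simp: torus_def mem_box_cart less_imp_le)
  then show "torus \<in> (lmeasurable :: (real^'d) set set)"
    using bounded_subset[OF bounded_cbox] by (intro bounded_set_imp_lmeasurable) auto
qed

lemma borel_measurable_lebesgue_on:
  "f \<in> borel_measurable borel \<Longrightarrow> f \<in> borel_measurable (lebesgue_on S)"
  by (intro measurable_restrict_space1 measurable_completion) simp

text \<open>For \<open>n \<noteq> 0\<close> the integrand has an antiderivative with equal values at
  0 and 1. The closed interval used by the fundamental theorem of calculus differs from the
  half-open one by a null set.\<close>

lemma integral_cis_unit_interval:
  "(LINT t|lborel. indicator {0..<1} t *\<^sub>R cis (2 * pi * (of_int n * t))) = (if n = 0 then 1 else 0)"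
proof -
  have "(LINT t|lborel. indicator {0..<1} t *\<^sub>R cis (2 * pi * (of_int n * t)))
      = (LINT t|lborel. indicator {0..1} t *\<^sub>R cis (2 * pi * (of_int n * t)))"
  proof (rule integral_cong_AE)
    show "AE t in lborel. indicator {0..<1} t *\<^sub>R cis (2 * pi * (of_int n * t))
        = indicator {0..1::real} t *\<^sub>R cis (2 * pi * (of_int n * t))"
      using AE_lborel_singleton[of "1::real"] by eventually_elim (auto simp: indicator_def)
  qed (auto simp: cis_conv_exp)
  also have "\<dots> = (if n = 0 then 1 else 0)"
  proof (cases "n = 0")
    case False
    define c where "c = 2 * pi * of_int n * \<i>"
    define F where "F t = exp (c * of_real t) / c" for t
    have c: "c \<noteq> 0" using False by (simp add: c_def)
    have cis: "cis (2 * pi * (of_int n * t)) = exp (c * of_real t)" for t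
      by (simp add: c_def cis_conv_exp mult_ac)
    have "(LINT t|lborel. indicator {0..1} t *\<^sub>R exp (c * of_real t)) = F 1 - F 0"
    proof (rule integral_FTC_atLeastAtMost)
      show "(F has_vector_derivative exp (c * of_real t)) (at t within {0..1})" for t
        unfolding F_def using c
        by (intro has_vector_derivative_real_field) (auto intro!: derivative_eq_intros)
      show "continuous_on {0..1} (\<lambda>t. exp (c * of_real t))"
        by (intro continuous_intros)
    qed simp
    moreover have "F 1 = F 0"
      using cis_2pi_int_add[of "of_int n" 0] cis[of 1] by (simp add: F_def)
    ultimately show ?thesis using False by (simp add: cis)
  qed simp
  finally show ?thesis .
qed

lemma axis_nth_if: "axis s n $ t = (if t = s then n else 0)"
  by (simp add: axis_def)

text \<open>By Fubini the integral over the cube is a product of the one-dimensional integrals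
  above, and a single nonzero coordinate of \<open>m\<close> makes it vanish.\<close>

lemma integral_character:
  "(LINT x|lebesgue_on torus. character (m :: int^'d) x) = (if m = 0 then 1 else 0)"
proof -
  define \<phi> where "\<phi> s t = indicator {0..<1} t *\<^sub>R cis (2 * pi * (of_int (m $ s) * t))"
    for s :: 'd and t :: real
  have \<phi>: "integrable lborel (\<phi> s)" for s
  proof -
    have "integrable lborel (\<lambda>t::real. indicator {0..<1} t * 1 :: real)"
      by (simp add: integrable_real_indicator)
    then show ?thesis
      by (rule Bochner_Integration.integrable_bound)
        (auto simp: \<phi>_def[abs_def] cis_conv_exp indicator_def)
  qed
  have split: "indicator torus x *\<^sub>R character m x = (\<Prod>s\<in>UNIV. \<phi> s (x $ s))" for x
  proof -
    have "character m x = (\<Prod>s\<in>UNIV. cis (2 * pi * (of_int (m $ s) * x $ s)))"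
      by (simp add: character_def cis_conv_exp sum_distrib_left flip: exp_sum)
    moreover have "(indicator torus x :: real) = (\<Prod>s\<in>UNIV. indicator {0..<1} (x $ s))"
      by (auto simp: torus_def indicator_def prod_zero_iff)
    ultimately show ?thesis
      by (simp add: \<phi>_def scaleR_conv_of_real prod.distrib)
  qed
  have inj: "inj (\<lambda>s::'d. axis s (1::real))" and Basis: "Basis = range (\<lambda>s::'d. axis s (1::real))"
    by (auto simp: inj_on_def axis_eq_axis Basis_vec_def)
  \<comment> \<open>\<open>lborel\<close> on \<open>real^'d\<close> is the image of a product
    measure indexed by \<open>Basis\<close>, so the factors are transported from coordinates
    \<open>s\<close> to basis vectors \<open>axis s 1\<close>.\<close>
  define \<psi> where "\<psi> b = \<phi> (THE s. b = axis s (1::real))" for b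
  have \<psi>: "\<psi> (axis s 1) = \<phi> s" for s
    unfolding \<psi>_def by (simp add: axis_eq_axis)
  interpret product_sigma_finite "\<lambda>_::real^'d. lborel :: real measure"
    by standard
  have "(LINT x|lebesgue_on torus. character m x) = (LINT x|lebesgue. indicator torus x *\<^sub>R character m x)"
    by (rule integral_restrict_space) simp
  also have "\<dots> = (LINT x|lborel. indicator torus x *\<^sub>R character m x)"
    by (rule integral_completion) measurable
  also have "\<dots> = (LINT f|(\<Pi>\<^sub>M b\<in>Basis. lborel). indicator torus (\<Sum>b\<in>Basis. f b *\<^sub>R b)
      *\<^sub>R character m (\<Sum>b\<in>Basis. f b *\<^sub>R b))"
    by (subst lborel_eq, subst integral_distr) (auto intro!: borel_measurable_scaleR)
  also have "\<dots> = (LINT f|(\<Pi>\<^sub>M b\<in>Basis. lborel). (\<Prod>b\<in>Basis. \<psi> b (f b)))"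
  proof (rule Bochner_Integration.integral_cong[OF refl])
    fix f :: "real^'d \<Rightarrow> real"
    have "(\<Sum>b\<in>Basis. f b *\<^sub>R b) $ s = f (axis s 1)" for s
      unfolding Basis sum.reindex[OF inj] by (simp add: axis_nth_if if_distrib cong: if_cong)
    then show "indicator torus (\<Sum>b\<in>Basis. f b *\<^sub>R b) *\<^sub>R character m (\<Sum>b\<in>Basis. f b *\<^sub>R b)
        = (\<Prod>b\<in>Basis. \<psi> b (f b))"
      unfolding split by (simp add: Basis prod.reindex[OF inj] \<psi>)
  qed
  also have "\<dots> = (\<Prod>b\<in>Basis. integral\<^sup>L lborel (\<psi> b))"
    by (rule product_integral_prod) (auto simp: Basis \<psi> \<phi>)
  also have "\<dots> = (\<Prod>s\<in>UNIV. integral\<^sup>L lborel (\<phi> s))"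
    by (simp add: Basis prod.reindex[OF inj] \<psi>)
  also have "\<dots> = (\<Prod>s\<in>UNIV. if m $ s = 0 then 1 else 0)"
    unfolding \<phi>_def integral_cis_unit_interval ..
  also have "\<dots> = (if m = 0 then 1 else 0)"
    by (auto simp: vec_eq_iff prod_zero_iff)
  finally show ?thesis .
qed

section \<open>Fourier coefficients of square-integrable functions\<close>

lemma integrable_mult_character:
  assumes "f \<in> L2_torus"
  shows "integrable (lebesgue_on torus) (\<lambda>x. f x * character k x)"
proof -
  interpret finite_measure "lebesgue_on (torus :: (real^'a) set)"
    by (rule finite_measure_torus)
  have f [measurable]: "f \<in> borel_measurable (lebesgue_on torus)"
    and sq: "integrable (lebesgue_on torus) (\<lambda>x. (cmod (f x))\<^sup>2)"
    using assms by (auto simp: L2_torus_def)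
  \<comment> \<open>On a set of finite measure, square integrability implies integrability.\<close>
  have "integrable (lebesgue_on torus) (\<lambda>x. cmod (f x))"
    by (rule square_integrable_imp_integrable[OF _ sq]) measurable
  moreover have [measurable]: "character k \<in> borel_measurable (lebesgue_on torus)"
    by (intro borel_measurable_lebesgue_on character_measurable)
  have "(\<lambda>x. f x * character k x) \<in> borel_measurable (lebesgue_on torus)"
    by measurable
  ultimately show ?thesis
    by (rule Bochner_Integration.integrable_bound) (simp add: norm_mult)
qed

text \<open>Linearity of the integral applies because both integrands are integrable; the integral
  of a non-integrable function is 0 by convention.\<close>

lemma fourier_coeff_diff:
  assumes "f \<in> L2_torus" "g \<in> L2_torus"
  shows "fourier_coeff (\<lambda>x. f x - g x) k = fourier_coeff f k - fourier_coeff g k"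
  using assms
  by (simp add: fourier_coeff_eq_integral left_diff_distrib integrable_mult_character)

lemma L2_torus_character_diff: "(\<lambda>x. c * (character k x - character h x)) \<in> L2_torus"
proof -
  interpret finite_measure "lebesgue_on (torus :: (real^'a) set)"
    by (rule finite_measure_torus)
  have [measurable]: "character k' \<in> borel_measurable (lebesgue_on torus)" for k' :: "int^'a"
    by (intro borel_measurable_lebesgue_on character_measurable)
  have "integrable (lebesgue_on torus) (\<lambda>x. (cmod (c * (character k x - character h x)))\<^sup>2)"
  proof (rule integrable_const_bound[where B = "(cmod c * 2)\<^sup>2"])
    have "cmod (character k x - character h x) \<le> 2" for x
      using norm_triangle_ineq4[of "character k x" "character h x"] by simp
    then have "norm ((cmod (c * (character k x - character h x)))\<^sup>2) \<le> (cmod c * 2)\<^sup>2" for x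
      unfolding real_norm_def abs_power2 norm_mult by (intro power_mono mult_left_mono) auto
    then show "AE x in lebesgue_on torus.
        norm ((cmod (c * (character k x - character h x)))\<^sup>2) \<le> (cmod c * 2)\<^sup>2"
      by simp
  qed simp
  then show ?thesis by (simp add: L2_torus_def)
qed

text \<open>Multiplication by \<open>character (- l)\<close> shifts both frequencies by
  \<open>- l\<close>, and orthogonality evaluates the two integrals.\<close>

lemma fourier_coeff_character_diff:
  "fourier_coeff (\<lambda>x. c * (character k x - character h x)) l
     = c * ((if l = k then 1 else 0) - (if l = h then 1 else 0))"
proof -
  interpret finite_measure "lebesgue_on (torus :: (real^'a) set)"
    by (rule finite_measure_torus)
  have int: "integrable (lebesgue_on torus) (character k')" for k' :: "int^'a"
    by (rule integrable_const_bound[where B = 1])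
      (auto intro: borel_measurable_lebesgue_on)
  have "c * (character k x - character h x) * character (- l) x
      = c * (character (k - l) x - character (h - l) x)" for x
    by (simp add: left_diff_distrib mult.assoc character_mult_minus)
  then have "fourier_coeff (\<lambda>x. c * (character k x - character h x)) l
      = (LINT x|lebesgue_on torus. c * (character (k - l) x - character (h - l) x))"
    unfolding fourier_coeff_eq_integral by (simp only:)
  then show ?thesis
    by (simp add: int integral_character)
qed

section \<open>Weights and norms\<close>

lemma H_weight_nonneg: "H_weight \<alpha> \<beta> k \<ge> 0"
  unfolding H_weight_def by (intro mult_nonneg_nonneg prod_nonneg) auto

lemma H_weight_pos: "H_weight \<alpha> \<beta> k > 0"
proof -
  have "1 + (\<Sum>s\<in>UNIV. (real_of_int (k $ s))\<^sup>2) > 0"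
    by (intro add_pos_nonneg sum_nonneg) auto
  moreover have "1 + \<bar>real_of_int (k $ s)\<bar>\<^sup>2 > 0" for s
    by (intro add_pos_nonneg) auto
  ultimately show ?thesis
    unfolding H_weight_def
    by (intro mult_pos_pos prod_pos) (auto simp: less_imp_neq[symmetric])
qed

text \<open>Only the coefficients at \<open>k\<close> and \<open>h\<close> survive, both of modulus
  \<open>cmod c\<close>; distinctness keeps them from cancelling.\<close>

lemma H_norm_character_diff:
  assumes "k \<noteq> h"
  shows "H_norm \<alpha> \<beta> (\<lambda>x. c * (character k x - character h x))
     = ennreal (cmod c * sqrt (H_weight \<alpha> \<beta> k + H_weight \<alpha> \<beta> h))"
proof -
  let ?f = "\<lambda>x. c * (character k x - character h x)"
  let ?F = "\<lambda>l. (cmod (fourier_coeff ?f l))\<^sup>2 * H_weight \<alpha> \<beta> l"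
  have "?F summable_on UNIV \<longleftrightarrow> ?F summable_on {k, h}"
    by (rule summable_on_cong_neutral) (auto simp: fourier_coeff_character_diff)
  then have "?f \<in> H_space \<alpha> \<beta>"
    by (simp add: H_space_def L2_torus_character_diff)
  moreover have "infsum ?F UNIV = infsum ?F {k, h}"
    by (rule infsum_cong_neutral) (auto simp: fourier_coeff_character_diff)
  then have "infsum ?F UNIV = (cmod c)\<^sup>2 * (H_weight \<alpha> \<beta> k + H_weight \<alpha> \<beta> h)"
    using assms by (simp add: fourier_coeff_character_diff distrib_left)
  ultimately show ?thesis
    by (simp add: H_norm_def real_sqrt_mult)
qed

text \<open>A term of a nonnegative series is at most its sum. Outside \<open>H_space\<close> the
  norm is infinite, so \<open>f\<close> may be arbitrary.\<close>

lemma fourier_coeff_le_H_norm: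
  "ennreal (cmod (fourier_coeff f k) * sqrt (H_weight \<alpha> \<beta> k)) \<le> H_norm \<alpha> \<beta> f"
proof (cases "f \<in> H_space \<alpha> \<beta>")
  case True
  let ?F = "\<lambda>l. (cmod (fourier_coeff f l))\<^sup>2 * H_weight \<alpha> \<beta> l"
  have "sum ?F {k} \<le> infsum ?F UNIV"
    using True by (intro finite_sum_le_infsum) (auto simp: H_space_def H_weight_nonneg)
  then have "sqrt (?F k) \<le> sqrt (infsum ?F UNIV)" by simp
  then show ?thesis
    using True by (simp add: H_norm_def real_sqrt_mult ennreal_leI)
qed (simp add: H_norm_def)

section \<open>The fooling argument for a fixed lattice\<close>

text \<open>The error is read off at the frequency \<open>k\<close>, which is the heavier one for
  the source norm, so that the bound involves the weights at \<open>k\<close> alone.\<close>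

lemma Samp_lattice_ge:
  fixes k h z :: "int^'d"
  assumes kh: "k \<noteq> h" and dvd: "int M dvd (\<Sum>s\<in>UNIV. (k $ s - h $ s) * z $ s)" and M: "M \<ge> 1"
    and le: "H_weight \<alpha> \<beta> h \<le> H_weight \<alpha> \<beta> k"
  shows "ennreal (sqrt (H_weight \<alpha>' \<beta>' k / (2 * H_weight \<alpha> \<beta> k)))
    \<le> Samp_lattice z M (H_norm \<alpha> \<beta>) (H_norm \<alpha>' \<beta>')"
  unfolding Samp_lattice_def
proof (rule INF_greatest)
  fix A :: "(nat \<Rightarrow> complex) \<Rightarrow> real^'d \<Rightarrow> complex"
  assume A: "A \<in> ({..<M} \<rightarrow>\<^sub>E (UNIV :: complex set)) \<rightarrow> {g. H_norm \<alpha>' \<beta>' g < \<infinity>}"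
  \<comment> \<open>This scale puts \<open>f r\<close> and \<open>f (- r)\<close> into the unit
    ball: the squared norm of the difference of the characters is the sum of both weights, at most
    \<open>2 * H_weight \<alpha> \<beta> k\<close> by \<open>le\<close>.\<close>
  define r where "r = 1 / sqrt (2 * H_weight \<alpha> \<beta> k)"
  have r: "r > 0" using H_weight_pos[of \<alpha> \<beta> k] by (simp add: r_def)
  define f where "f c x = complex_of_real c * (character k x - character h x)" for c x
  \<comment> \<open>The output for zero data is the common approximation of \<open>f r\<close> and
    \<open>f (- r)\<close>.\<close>
  define g where "g = A (\<lambda>j\<in>{..<M}. 0)"
  let ?S = "SUP f \<in> {f. continuous_torus f \<and> H_norm \<alpha> \<beta> f \<le> 1}.
    H_norm \<alpha>' \<beta>' (\<lambda>x. f x - A (\<lambda>j\<in>{..<M}. f (lattice_point z M j)) x)"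
  \<comment> \<open>Finite target norm puts \<open>g\<close> into \<open>L2_torus\<close>, where
    coefficients can be subtracted.\<close>
  have "H_norm \<alpha>' \<beta>' g < \<infinity>"
    using funcset_mem[OF A, of "\<lambda>j\<in>{..<M}. 0"] unfolding g_def by simp
  then have g: "g \<in> L2_torus"
    by (auto simp: H_norm_def H_space_def split: if_splits)
  have upper: "ennreal (cmod (of_real c - fourier_coeff g k) * sqrt (H_weight \<alpha>' \<beta>' k)) \<le> ?S"
    if c: "\<bar>c\<bar> = r" for c
  proof -
    have "sqrt (H_weight \<alpha> \<beta> k + H_weight \<alpha> \<beta> h) \<le> sqrt (2 * H_weight \<alpha> \<beta> k)"
      using le by simp
    then have "r * sqrt (H_weight \<alpha> \<beta> k + H_weight \<alpha> \<beta> h) \<le> 1"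
      using H_weight_pos[of \<alpha> \<beta> k] by (simp add: r_def divide_le_eq_1)
    then have "H_norm \<alpha> \<beta> (f c) \<le> 1"
      unfolding f_def H_norm_character_diff[OF kh] using c by simp
    moreover have "continuous_torus (f c)"
      unfolding f_def by (rule continuous_torus_character_diff)
    moreover have "(\<lambda>j\<in>{..<M}. f c (lattice_point z M j)) = (\<lambda>j\<in>{..<M}. 0)"
      using character_lattice_point_eq[OF dvd M] by (simp add: f_def)
    ultimately have "H_norm \<alpha>' \<beta>' (\<lambda>x. f c x - g x) \<le> ?S"
      unfolding g_def by (intro SUP_upper2[of "f c"]) simp_all
    moreover have "fourier_coeff (\<lambda>x. f c x - g x) k = of_real c - fourier_coeff g k"
      using kh g unfolding f_def
      by (simp add: fourier_coeff_diff L2_torus_character_diff fourier_coeff_character_diff)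
    ultimately show ?thesis
      using order_trans[OF fourier_coeff_le_H_norm[of "\<lambda>x. f c x - g x" k \<alpha>' \<beta>']] by simp
  qed
  \<comment> \<open>The coefficients \<open>r\<close> and \<open>- r\<close> at \<open>k\<close> are
    \<open>2 * r\<close> apart, so that of \<open>g\<close> has distance at least \<open>r\<close>
    from one of them.\<close>
  have "2 * r = cmod ((of_real r - fourier_coeff g k) - (of_real (- r) - fourier_coeff g k))"
    using r by (simp flip: of_real_add)
  also have "\<dots> \<le> cmod (of_real r - fourier_coeff g k) + cmod (of_real (- r) - fourier_coeff g k)"
    by (rule norm_triangle_ineq4)
  finally have "r \<le> cmod (of_real r - fourier_coeff g k) \<or> r \<le> cmod (of_real (- r) - fourier_coeff g k)"
    by linarith
  moreover have "\<bar>r\<bar> = r" "\<bar>- r\<bar> = r" using r by simp_all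
  ultimately obtain c where c: "\<bar>c\<bar> = r" "r \<le> cmod (of_real c - fourier_coeff g k)"
    by blast
  have "sqrt (H_weight \<alpha>' \<beta>' k / (2 * H_weight \<alpha> \<beta> k)) = r * sqrt (H_weight \<alpha>' \<beta>' k)"
    by (simp add: r_def real_sqrt_divide)
  also have "\<dots> \<le> cmod (of_real c - fourier_coeff g k) * sqrt (H_weight \<alpha>' \<beta>' k)"
    using c(2) by (intro mult_right_mono) (auto simp: H_weight_nonneg)
  finally show "ennreal (sqrt (H_weight \<alpha>' \<beta>' k / (2 * H_weight \<alpha> \<beta> k))) \<le> ?S"
    by (rule order_trans[OF ennreal_leI upper[OF c(1)]])
qed

section \<open>Short frequencies on two axes and the resulting rate\<close>

lemma H_weight_axis: "H_weight \<alpha> \<beta> (axis s n) = (1 + (real_of_int n)\<^sup>2) powr (\<alpha> + \<beta>)"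
proof -
  have "(\<Sum>t\<in>UNIV. (real_of_int (axis s n $ t))\<^sup>2) = (real_of_int n)\<^sup>2"
    by (subst sum.mono_neutral_right[of UNIV "{s}"]) (auto simp: axis_nth_if)
  moreover have "(\<Prod>t\<in>UNIV. (1 + \<bar>real_of_int (axis s n $ t)\<bar>\<^sup>2) powr \<alpha>) = (1 + (real_of_int n)\<^sup>2) powr \<alpha>"
    by (subst prod.mono_neutral_right[of UNIV "{s}"]) (auto simp: axis_nth_if)
  ultimately show ?thesis
    by (simp add: H_weight_def powr_add mult.commute)
qed

text \<open>With \<open>n\<close> the integer square root of \<open>M\<close>, the grid with
  \<open>n + 1\<close> values per side has more than \<open>M\<close> points. Two of them share a
  residue of the linear form modulo \<open>M\<close>, and their difference is the relation.\<close>

lemma lattice_short_relation: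
  fixes u v :: int
  assumes "M \<ge> 1"
  obtains a b :: int where "a \<noteq> 0 \<or> b \<noteq> 0" "a\<^sup>2 \<le> int M" "b\<^sup>2 \<le> int M" "int M dvd a * u + b * v"
proof -
  obtain n :: nat where n: "n\<^sup>2 \<le> M" "M < (Suc n)\<^sup>2"
    by (metis Suc_floor_sqrt_power2_gt floor_sqrt_power2_le)
  define Q where "Q = {0..int n} \<times> {0..int n}"
  define F where "F p = (fst p * u + snd p * v) mod int M" for p :: "int \<times> int"
  have "F ` Q \<subseteq> {0..<int M}"
    using assms by (auto simp: F_def)
  then have "card (F ` Q) \<le> M"
    using card_mono[of "{0..<int M}" "F ` Q"] by simp
  also have "M < card Q"
    using n(2) by (simp add: Q_def card_cartesian_product power2_eq_square nat_add_distrib)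
  finally have "\<not> inj_on F Q" by (rule pigeonhole)
  then obtain p q where pq: "p \<in> Q" "q \<in> Q" "p \<noteq> q" "F p = F q"
    unfolding inj_on_def by blast
  have sq: "d\<^sup>2 \<le> int M" if "\<bar>d\<bar> \<le> int n" for d :: int
  proof -
    have "d\<^sup>2 \<le> (int n)\<^sup>2" using power_mono[OF that, of 2] by simp
    also have "\<dots> \<le> int M" using n(1) by (simp flip: of_nat_power)
    finally show ?thesis .
  qed
  have "int M dvd (fst p * u + snd p * v) - (fst q * u + snd q * v)"
    using pq(4) by (simp add: F_def mod_eq_dvd_iff)
  then have "int M dvd (fst p - fst q) * u + (snd p - snd q) * v"
    by (simp add: algebra_simps)
  moreover have "fst p - fst q \<noteq> 0 \<or> snd p - snd q \<noteq> 0"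
    using pq(3) by (simp add: prod_eq_iff)
  moreover have "(fst p - fst q)\<^sup>2 \<le> int M" "(snd p - snd q)\<^sup>2 \<le> int M"
    using pq(1,2) by (auto simp: Q_def intro!: sq)
  ultimately show ?thesis using that by blast
qed

text \<open>The short relation is applied to two coordinates of \<open>z\<close>. General target
  exponents let one proof serve the isotropic and the mixed norm.\<close>

lemma Samp_lattice_axis_ge:
  fixes z :: "int^'d"
  assumes d: "CARD('d) \<ge> 2" and a: "\<alpha> + \<beta> \<ge> 0" "\<alpha> + \<beta> \<ge> \<alpha>' + \<beta>'" and M: "M \<ge> 1"
  defines "\<delta> \<equiv> \<alpha> + \<beta> - (\<alpha>' + \<beta>')"
  shows "ennreal (2 powr (- (\<delta> + 1) / 2) * real M powr (- \<delta> / 2))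
    \<le> Samp_lattice z M (H_norm \<alpha> \<beta>) (H_norm \<alpha>' \<beta>')"
proof -
  obtain s t :: 'd where st: "s \<noteq> t"
    using d by (metis UNIV_I card_2_iff' card_le_Suc0_iff_eq finite not_less_eq_eq numeral_2_eq_2)
  obtain a b where ab: "a \<noteq> 0 \<or> b \<noteq> 0" "a\<^sup>2 \<le> int M" "b\<^sup>2 \<le> int M" "int M dvd a * z $ s + b * z $ t"
    using lattice_short_relation[OF M] by blast
  \<comment> \<open>By symmetry \<open>a\<close> may be the coefficient of larger modulus; since
    \<open>\<alpha> + \<beta> \<ge> 0\<close>, its frequency is then the heavier one.\<close>
  have bound: "ennreal (2 powr (- (\<delta> + 1) / 2) * real M powr (- \<delta> / 2))
      \<le> Samp_lattice z M (H_norm \<alpha> \<beta>) (H_norm \<alpha>' \<beta>')"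
    if st: "s \<noteq> t" and ab: "a \<noteq> 0 \<or> b \<noteq> 0" "a\<^sup>2 \<le> int M" "b\<^sup>2 \<le> a\<^sup>2"
      and dvd: "int M dvd a * z $ s + b * z $ t"
    for a b and s t :: 'd
  proof -
    \<comment> \<open>The minus sign makes the pairing of \<open>?k - ?h\<close> with
      \<open>z\<close> equal to the relation.\<close>
    let ?k = "axis s a" and ?h = "axis t (- b)"
    have kh: "?k \<noteq> ?h" using st ab by (auto simp: axis_eq_axis)
    have "(\<Sum>i\<in>UNIV. (?k $ i - ?h $ i) * z $ i) = (\<Sum>i\<in>{s, t}. (?k $ i - ?h $ i) * z $ i)"
      by (rule sum.mono_neutral_right) (auto simp: axis_nth_if)
    also have "\<dots> = a * z $ s + b * z $ t"
      using st by (simp add: axis_nth_if)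
    finally have dvd': "int M dvd (\<Sum>i\<in>UNIV. (?k $ i - ?h $ i) * z $ i)"
      using dvd by simp
    have ab': "(real_of_int b)\<^sup>2 \<le> (real_of_int a)\<^sup>2" "(real_of_int a)\<^sup>2 \<le> real M"
      using ab by (simp_all flip: of_int_power add: of_int_le_iff)
    define w where "w = 1 + (real_of_int a)\<^sup>2"
    \<comment> \<open>The factor 2 here becomes \<open>2 powr (- \<delta> / 2)\<close> in the
      constant; the other \<open>2 powr (- 1 / 2)\<close> comes from the two frequencies in the norm
      of the fooling function.\<close>
    have w: "1 \<le> w" "w \<le> 2 * real M" using ab' M by (simp_all add: w_def)
    have le: "H_weight \<alpha> \<beta> ?h \<le> H_weight \<alpha> \<beta> ?k"
      unfolding H_weight_axis using ab' a by (intro powr_mono2) (auto intro: add_nonneg_nonneg)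
    have "2 powr (- (\<delta> + 1) / 2) * real M powr (- \<delta> / 2) = 2 powr (- 1 / 2) * (2 * real M) powr (- \<delta> / 2)"
    proof -
      have "- (\<delta> + 1) / 2 = - 1 / 2 + - \<delta> / 2" by (simp add: field_simps)
      then show ?thesis by (simp only: powr_add powr_mult mult.assoc)
    qed
    \<comment> \<open>The exponent is nonpositive as \<open>\<delta> \<ge> 0\<close>, so the upper
      bound on \<open>w\<close> bounds its power from below.\<close>
    also have "\<dots> \<le> 2 powr (- 1 / 2) * w powr (- \<delta> / 2)"
      using w a by (intro mult_left_mono powr_mono2') (auto simp: \<delta>_def)
    also have "\<dots> = sqrt (w powr (\<alpha>' + \<beta>') / (2 * w powr (\<alpha> + \<beta>)))"
    proof -
      have eq: "w powr (\<alpha>' + \<beta>') / (2 * w powr (\<alpha> + \<beta>)) = (2 powr - 1) * w powr (- \<delta>)"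
        using w by (simp add: \<delta>_def powr_diff powr_minus field_simps)
      have "sqrt ((2 powr - 1) * w powr (- \<delta>)) = ((2 powr - 1) * w powr (- \<delta>)) powr (1 / 2)"
        by (intro powr_half_sqrt[symmetric] mult_nonneg_nonneg powr_ge_zero)
      also have "\<dots> = 2 powr (- 1 / 2) * w powr (- \<delta> / 2)"
        by (simp only: powr_mult powr_powr) simp
      finally show ?thesis by (simp only: eq)
    qed
    finally have "2 powr (- (\<delta> + 1) / 2) * real M powr (- \<delta> / 2)
        \<le> sqrt (H_weight \<alpha>' \<beta>' ?k / (2 * H_weight \<alpha> \<beta> ?k))"
      by (simp add: H_weight_axis w_def)
    then show ?thesis
      by (rule order_trans[OF ennreal_leI Samp_lattice_ge[OF kh dvd' M le]])
  qed
  show ?thesis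
  proof (cases "b\<^sup>2 \<le> a\<^sup>2")
    case True
    then show ?thesis using bound[OF st] ab by blast
  next
    case False
    \<comment> \<open>Here \<open>b\<close> has the larger modulus, so the two axes exchange
      roles.\<close>
    then show ?thesis using bound[of t s b a] st ab by (auto simp: add.commute)
  qed
qed

theorem theorem3p2:
  fixes \<alpha> \<beta> \<gamma> :: real and M :: nat
  assumes "CARD('d::finite) \<ge> 2"
    and "\<alpha> > \<gamma> - \<beta>" and "\<gamma> - \<beta> \<ge> 0" and "\<alpha> + \<beta> > 1/2"
    and "M \<ge> 1"
  shows "g_latt1 M (H_norm \<alpha> \<beta> :: (real^'d \<Rightarrow> complex) \<Rightarrow> ennreal) (H_iso_norm \<gamma>)
           \<ge> ennreal (2 powr (- (\<alpha> + \<beta> - \<gamma> + 1) / 2) * real M powr (- (\<alpha> + \<beta> - \<gamma>) / 2))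
       \<and> g_latt1 M (H_norm \<alpha> \<beta> :: (real^'d \<Rightarrow> complex) \<Rightarrow> ennreal) (H_mix_norm \<gamma>)
           \<ge> ennreal (2 powr (- (\<alpha> + \<beta> - \<gamma> + 1) / 2) * real M powr (- (\<alpha> + \<beta> - \<gamma>) / 2))"
  \<comment> \<open>Both targets have exponent sum \<open>\<gamma>\<close>, so
    \<open>\<delta>\<close> is \<open>\<alpha> + \<beta> - \<gamma>\<close> in both instances. The
    bound is uniform in \<open>z\<close> and passes to the infimum.\<close>
  using assms Samp_lattice_axis_ge[where 'd = 'd and \<alpha> = \<alpha> and \<beta> = \<beta> and M = M and \<alpha>' = 0 and \<beta>' = \<gamma>]
    Samp_lattice_axis_ge[where 'd = 'd and \<alpha> = \<alpha> and \<beta> = \<beta> and M = M and \<alpha>' = \<gamma> and \<beta>' = 0]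
  unfolding g_latt1_def by (auto intro!: INF_greatest)

end
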